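(* Suppose that the standing assumptions (SA1), (SA2), (SA3) of the context hold and that PI is recursively feasible, i.e. $H^i(x)\neq\emptyset$ for every $i\in\mathbb{Z}_{>0}$ and every $x\in\mathbb{R}^{n_x}$. Then, for any $i\in\mathbb{Z}_{\ge0}$, any $x\in\mathbb{R}^{n_x}$, any solution $\phi^i(\cdot,x)$, initialized at $x$, of the difference inclusion $x(k+1)\in F^i(x(k)):=f(x(k),H^i(x(k)))$, and any $k\in\mathbb{Z}_{\ge0}$, $$\sigma(\phi^i(k,x))\le\beta(\sigma(x),k),$$ where $\beta\in\mathcal{KL}$ is given by $\beta(s,k)=\underline\alpha_Y^{-1}\circ(\mathbb{I}-\widetilde\alpha_Y)^{(k)}\circ\overline\alpha_Y(s)$, with $\underline\alpha_Y,\overline\alpha_Y,\widetilde\alpha_Y$ defined in the context (in particular $\beta$ does not depend on $i$).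
   Context: Notation. $\mathbb{R}_{\ge0}=[0,\infty)$, $\mathbb{Z}_{\ge0}=\{0,1,\dots\}$, $\mathbb{Z}_{>0}=\{1,2,\dots\}$. $\mathbb{I}$ is the identity on $\mathbb{R}_{\ge0}$; $g^{(k)}$ is the $k$-fold composition of $g$ with itself, $g^{(0)}=\mathbb{I}$. $\mathcal{K}_\infty$: continuous, strictly increasing, unbounded functions $\mathbb{R}_{\ge0}\to\mathbb{R}_{\ge0}$ that are zero at zero. $\mathcal{KL}$: functions $\beta(s,k)\ge0$ of $s\in\mathbb{R}_{\ge0}$ and $k$ (here $k\in\mathbb{Z}_{\ge0}$), nondecreasing in $s$ with $\lim_{s\to0^+}\beta(s,k)=0$ for each $k$, and nonincreasing in $k$ with $\lim_{k\to\infty}\beta(s,k)=0$ for each $s$. A selection of a set-valued map $S$ is a single-valued $s$ with $s(x)\in S(x)$ for all $x\in\operatorname{dom}S$; one writes $s\in S$. Plant and cost. $x(k+1)=f(x(k),u(k))$ with $x\in\mathbb{R}^{n_x}$, $u\in\mathcal{U}(x)\subseteq\mathbb{R}^{n_u}$, $\mathcal{U}(x)\neq\emptyset$ for every $x$; $\mathcal{W}=\{(x,u):u\in\mathcal{U}(x)\}$. The stage cost is $\ell:\mathbb{R}^{n_x}\times\mathbb{R}^{n_u}\to\mathbb{R}_{\ge0}$. For an admissible infinite input sequence $\mathbf{u}=(u(0),u(1),\dots)$, $J(x,\mathbf{u})=\sum_{k=0}^\infty\ell(x(k),u(k))$ along the resulting solution from $x(0)=x$. For a feedback law (policy) $h$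 with $h\in\mathcal{U}$, $\phi(k,x,h)$ is the closed-loop solution from $x$ and $J(x,h)=\sum_{k=0}^\infty\ell(\phi(k,x,h),h(\phi(k,x,h)))$. $V^\star(x)=\min_{\mathbf{u}}J(x,\mathbf{u})$. Standing assumptions. $\sigma:\mathbb{R}^{n_x}\to\mathbb{R}_{\ge0}$ is continuous, and $h^0\in\mathcal{U}$ is a given initial policy. (SA1) For every $x$ there is an admissible input sequence $\mathbf{u}^\star(x)$ attaining the minimum $V^\star(x)=J(x,\mathbf{u}^\star(x))<+\infty$. (SA2) There exist a continuous $W:\mathbb{R}^{n_x}\to\mathbb{R}_{\ge0}$, $\alpha_W,\chi_W\in\mathcal{K}_\infty$ and $\overline\alpha_W:\mathbb{R}_{\ge0}\to\mathbb{R}_{\ge0}$ continuous, nondecreasing and zero at zero such that for all $(x,u)\in\mathcal{W}$: $W(x)\le\overline\alpha_W(\sigma(x))$ and $W(f(x,u))-W(x)\le-\alpha_W(\sigma(x))+\chi_W(\ell(x,u))$. (SA3) There exists $\overline\alpha_V\in\mathcal{K}_\infty$ with $J(x,h^0)\le\overline\alpha_V(\sigma(x))$ for all $x\in\mathbb{R}^{n_x}$. Policy iteration (PI). $V^0:=J(\cdot,h^0)$, $H^0:=\{h^0\}$. For $i\in\mathbb{Z}_{\ge0}$: $H^{i+1}(x):=\operatorname{argmin}_{u\in\mathcal{U}(x)}\{\ell(x,u)+V^i(f(x,u))\}$; an arbitrary selection $h^{i+1}\in H^{i+1}$ is taken; $V^{i+1}:=J(\cdot,h^{i+1})$. Functions.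 General case: $q_V(s)=2\chi_W(2s)$; $q_W=\tfrac12[\chi_W+(\overline\alpha_W+\mathbb{I})\circ\alpha_W^{-1}(2\chi_W)]^{-1}$ (one half of the inverse function); $\rho_V(s)=\int_0^sq_V(\tau)d\tau$; $\rho_W(s)=\int_0^sq_W(\tau)d\tau$; $\alpha_Y=q_W(\tfrac14\alpha_W)\,\tfrac14\alpha_W$; $\overline\alpha_Y=\rho_V\circ\overline\alpha_V+\rho_W\circ\overline\alpha_W$; $\underline\alpha_Y=\min\{\rho_V\circ\chi_W^{-1}(\tfrac12\alpha_W),\rho_W(\tfrac12\alpha_W)\}$; $\widetilde\alpha_Y=\alpha_Y\circ\overline\alpha_Y^{-1}$. When $\chi_W\le\mathbb{I}$, instead: $\alpha_Y=\alpha_W$, $\overline\alpha_Y=\overline\alpha_V+\overline\alpha_W$, $\underline\alpha_Y=\alpha_W$, $\widetilde\alpha_Y=\alpha_Y\circ\overline\alpha_Y^{-1}$. Convention: $\mathbb{I}-\widetilde\alpha_Y$ is assumed non-decreasing; if it is not, $(\mathbb{I}-\widetilde\alpha_Y)^{(k)}$ in the formula of $\beta$ is replaced by $s\mapsto\max_{\hat s\in[0,s]}(\mathbb{I}-\widetilde\alpha_Y)^{(k)}(\hat s)$. *)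

theory Defs
  imports "HOL-Analysis.Analysis"
begin

section \<open>Comparison functions\<close>

text \<open>Functions on the nonnegative reals are total functions on the reals, constrained and
  used on \<open>{0..}\<close> only; accordingly the inverse of a comparison function \<open>\<alpha>\<close> is
  \<open>inv_into {0..} \<alpha>\<close>.\<close>

definition class_Kinf :: "(real \<Rightarrow> real) \<Rightarrow> bool" where
  "class_Kinf \<alpha> \<longleftrightarrow> continuous_on {0..} \<alpha> \<and> strict_mono_on {0..} \<alpha> \<and> \<alpha> 0 = 0 \<and>
     (\<forall>M. \<exists>s\<ge>0. M < \<alpha> s)"

definition class_KL :: "(real \<Rightarrow> nat \<Rightarrow> real) \<Rightarrow> bool" where
  "class_KL \<beta> \<longleftrightarrow>
     (\<forall>s\<ge>0. \<forall>k. 0 \<le> \<beta> s k) \<and>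
     (\<forall>k. mono_on {0..} (\<lambda>s. \<beta> s k) \<and> ((\<lambda>s. \<beta> s k) \<longlongrightarrow> 0) (at_right 0)) \<and>
     (\<forall>s\<ge>0. antimono (\<beta> s) \<and> \<beta> s \<longlonglongrightarrow> 0)"

abbreviation inv0 :: "(real \<Rightarrow> real) \<Rightarrow> real \<Rightarrow> real" where
  "inv0 \<alpha> \<equiv> inv_into {0..} \<alpha>"


section \<open>Plant, costs and policy iteration\<close>

definition selection :: "('x \<Rightarrow> 'u) \<Rightarrow> ('x \<Rightarrow> 'u set) \<Rightarrow> bool" where
  "selection s S \<longleftrightarrow> (\<forall>x. S x \<noteq> {} \<longrightarrow> s x \<in> S x)"

primrec trajectory :: "('x \<Rightarrow> 'u \<Rightarrow> 'x) \<Rightarrow> 'x \<Rightarrow> (nat \<Rightarrow> 'u) \<Rightarrow> nat \<Rightarrow> 'x" where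
  "trajectory f x u 0 = x"
| "trajectory f x u (Suc k) = f (trajectory f x u k) (u k)"

definition admissible ::
  "('x \<Rightarrow> 'u \<Rightarrow> 'x) \<Rightarrow> ('x \<Rightarrow> 'u set) \<Rightarrow> 'x \<Rightarrow> (nat \<Rightarrow> 'u) \<Rightarrow> bool" where
  "admissible f U x u \<longleftrightarrow> (\<forall>k. u k \<in> U (trajectory f x u k))"

text \<open>Costs may be infinite, hence take values in \<^typ>\<open>ennreal\<close>.\<close>

definition input_cost ::
  "('x \<Rightarrow> 'u \<Rightarrow> 'x) \<Rightarrow> ('x \<Rightarrow> 'u \<Rightarrow> real) \<Rightarrow> 'x \<Rightarrow> (nat \<Rightarrow> 'u) \<Rightarrow> ennreal" where
  "input_cost f l x u = (\<Sum>k. ennreal (l (trajectory f x u k) (u k)))"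

definition optimal_cost ::
  "('x \<Rightarrow> 'u \<Rightarrow> 'x) \<Rightarrow> ('x \<Rightarrow> 'u set) \<Rightarrow> ('x \<Rightarrow> 'u \<Rightarrow> real) \<Rightarrow> 'x \<Rightarrow> ennreal" where
  "optimal_cost f U l x = (INF u\<in>{u. admissible f U x u}. input_cost f l x u)"

definition closed_loop :: "('x \<Rightarrow> 'u \<Rightarrow> 'x) \<Rightarrow> ('x \<Rightarrow> 'u) \<Rightarrow> nat \<Rightarrow> 'x \<Rightarrow> 'x" where
  "closed_loop f h k = (\<lambda>z. f z (h z)) ^^ k"

definition policy_cost ::
  "('x \<Rightarrow> 'u \<Rightarrow> 'x) \<Rightarrow> ('x \<Rightarrow> 'u \<Rightarrow> real) \<Rightarrow> ('x \<Rightarrow> 'u) \<Rightarrow> 'x \<Rightarrow> ennreal" where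
  "policy_cost f l h x = (\<Sum>k. ennreal (l (closed_loop f h k x) (h (closed_loop f h k x))))"

text \<open>\<open>PI_inputs f U l h i\<close> is the set-valued map \<open>H\<^sup>i\<close>, where \<open>h j\<close> is the policy selected at
  iteration \<open>j\<close>; it depends on \<open>h\<close> only through \<open>h 0\<close> if \<open>i = 0\<close> and through \<open>h (i - 1)\<close>
  otherwise.\<close>

definition PI_inputs ::
  "('x \<Rightarrow> 'u \<Rightarrow> 'x) \<Rightarrow> ('x \<Rightarrow> 'u set) \<Rightarrow> ('x \<Rightarrow> 'u \<Rightarrow> real) \<Rightarrow> (nat \<Rightarrow> 'x \<Rightarrow> 'u) \<Rightarrow>
     nat \<Rightarrow> 'x \<Rightarrow> 'u set" where
  "PI_inputs f U l h i x = (case i of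
       0 \<Rightarrow> {h 0 x}
     | Suc j \<Rightarrow> {u. is_arg_min (\<lambda>v. ennreal (l x v) + policy_cost f l (h j) (f x v))
                      (\<lambda>v. v \<in> U x) u})"

definition PI_dynamics ::
  "('x \<Rightarrow> 'u \<Rightarrow> 'x) \<Rightarrow> ('x \<Rightarrow> 'u set) \<Rightarrow> ('x \<Rightarrow> 'u \<Rightarrow> real) \<Rightarrow> (nat \<Rightarrow> 'x \<Rightarrow> 'u) \<Rightarrow>
     nat \<Rightarrow> 'x \<Rightarrow> 'x set" where
  "PI_dynamics f U l h i x = f x ` PI_inputs f U l h i x"


section \<open>The functions entering the stability bound\<close>

text \<open>In the names below, \<open>aW\<close>, \<open>aWb\<close>, \<open>cW\<close> and \<open>aVb\<close> stand for
  \<open>\<alpha>\<^sub>W\<close>, overlined \<open>\<alpha>\<^sub>W\<close>, \<open>\<chi>\<^sub>W\<close> and overlined \<open>\<alpha>\<^sub>V\<close>.\<close>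

definition q_V :: "(real \<Rightarrow> real) \<Rightarrow> real \<Rightarrow> real" where
  "q_V cW s = 2 * cW (2 * s)"

definition q_W :: "(real \<Rightarrow> real) \<Rightarrow> (real \<Rightarrow> real) \<Rightarrow> (real \<Rightarrow> real) \<Rightarrow> real \<Rightarrow> real" where
  "q_W aW aWb cW s =
     1/2 * inv0 (\<lambda>r. cW r + (aWb (inv0 aW (2 * cW r)) + inv0 aW (2 * cW r))) s"

definition rho_V :: "(real \<Rightarrow> real) \<Rightarrow> real \<Rightarrow> real" where
  "rho_V cW s = integral {0..s} (q_V cW)"

definition rho_W :: "(real \<Rightarrow> real) \<Rightarrow> (real \<Rightarrow> real) \<Rightarrow> (real \<Rightarrow> real) \<Rightarrow> real \<Rightarrow> real" where
  "rho_W aW aWb cW s = integral {0..s} (q_W aW aWb cW)"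

definition below_id :: "(real \<Rightarrow> real) \<Rightarrow> bool" where
  "below_id g \<longleftrightarrow> (\<forall>s\<ge>0. g s \<le> s)"

definition alpha_Y :: "(real \<Rightarrow> real) \<Rightarrow> (real \<Rightarrow> real) \<Rightarrow> (real \<Rightarrow> real) \<Rightarrow> real \<Rightarrow> real" where
  "alpha_Y aW aWb cW s =
     (if below_id cW then aW s
      else q_W aW aWb cW (1/4 * aW s) * (1/4 * aW s))"

definition upper_Y ::
  "(real \<Rightarrow> real) \<Rightarrow> (real \<Rightarrow> real) \<Rightarrow> (real \<Rightarrow> real) \<Rightarrow> (real \<Rightarrow> real) \<Rightarrow> real \<Rightarrow> real" where
  "upper_Y aW aWb cW aVb s =
     (if below_id cW then aVb s + aWb s
      else rho_V cW (aVb s) + rho_W aW aWb cW (aWb s))"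

definition lower_Y :: "(real \<Rightarrow> real) \<Rightarrow> (real \<Rightarrow> real) \<Rightarrow> (real \<Rightarrow> real) \<Rightarrow> real \<Rightarrow> real" where
  "lower_Y aW aWb cW s =
     (if below_id cW then aW s
      else min (rho_V cW (inv0 cW (1/2 * aW s))) (rho_W aW aWb cW (1/2 * aW s)))"

definition tilde_Y ::
  "(real \<Rightarrow> real) \<Rightarrow> (real \<Rightarrow> real) \<Rightarrow> (real \<Rightarrow> real) \<Rightarrow> (real \<Rightarrow> real) \<Rightarrow> real \<Rightarrow> real" where
  "tilde_Y aW aWb cW aVb s = alpha_Y aW aWb cW (inv0 (upper_Y aW aWb cW aVb) s)"

text \<open>\<open>id_minus_iter a k\<close> is the \<open>k\<close>-th iterate of \<open>s \<mapsto> s - a s\<close> if this map is nondecreasing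
  on \<open>{0..}\<close> (with \<open>a 0 = 0\<close> it then maps \<open>{0..}\<close> to itself), and the running maximum over
  \<open>[0, s]\<close> of that iterate otherwise. In the latter case \<open>s - a s\<close> may be negative at some
  \<open>s\<close>, where \<open>a\<close> could not be applied again; truncating at \<open>0\<close> keeps the iterates
  inside \<open>{0..}\<close> and changes nothing when \<open>a s \<le> s\<close> on \<open>{0..}\<close>. For continuous \<open>a\<close> the supremum
  is attained.\<close>

definition id_minus_iter :: "(real \<Rightarrow> real) \<Rightarrow> nat \<Rightarrow> real \<Rightarrow> real" where
  "id_minus_iter a k s =
     (if mono_on {0..} (\<lambda>r. r - a r) then ((\<lambda>r. r - a r) ^^ k) s
      else (SUP t\<in>{0..s}. ((\<lambda>r. max 0 (r - a r)) ^^ k) t))"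

definition beta_Y ::
  "(real \<Rightarrow> real) \<Rightarrow> (real \<Rightarrow> real) \<Rightarrow> (real \<Rightarrow> real) \<Rightarrow> (real \<Rightarrow> real) \<Rightarrow>
     real \<Rightarrow> nat \<Rightarrow> real" where
  "beta_Y aW aWb cW aVb s k =
     inv0 (lower_Y aW aWb cW)
       (id_minus_iter (tilde_Y aW aWb cW aVb) k (upper_Y aW aWb cW aVb s))"

end

theory Submission
  imports Defs
begin

text \<open>If \<open>u\<close> minimises the right-hand side defining the inputs of iteration \<open>i + 1\<close>, then
  \<open>l(x, u) + V\<^sup>i(f(x, u)) \<le> V\<^sup>i(x)\<close>: the policy \<open>h\<^sup>i\<close> is a competitor. Hence \<open>V\<^sup>i\<^sup>+\<^sup>1 \<le> V\<^sup>i \<le> V\<^sup>0\<close>,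
  and along \<open>F\<^sup>i\<^sup>+\<^sup>1\<close> it is \<open>V\<^sup>i\<close>, not \<open>V\<^sup>i\<^sup>+\<^sup>1\<close>, that serves as Lyapunov function, which makes
  the argument insensitive to the choice of selections (along \<open>F\<^sup>0\<close> one takes \<open>V\<^sup>0\<close>).
  The function \<open>Y = \<rho>\<^sub>V(V\<^sup>i) + \<rho>\<^sub>W(W)\<close> (or \<open>V\<^sup>i + W\<close>) then decreases by at least
  \<open>\<alpha>\<^sub>Y(\<sigma>(x))\<close>: the convex weights \<open>\<rho>\<^sub>V\<close>, \<open>\<rho>\<^sub>W\<close> let the decrease of \<open>V\<^sup>i\<close> absorb the term
  \<open>\<chi>\<^sub>W(l)\<close> when it dominates \<open>\<alpha>\<^sub>W(\<sigma>)\<close>, and otherwise \<open>W\<close> itself decreases.\<close>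

section \<open>Comparison functions\<close>

lemma Kinf_continuous: "class_Kinf a \<Longrightarrow> continuous_on {0..} a"
  and Kinf_zero: "class_Kinf a \<Longrightarrow> a 0 = 0"
  and Kinf_strict_mono: "class_Kinf a \<Longrightarrow> strict_mono_on {0..} a"
  by (auto simp: class_Kinf_def)

lemma Kinf_less: "class_Kinf a \<Longrightarrow> 0 \<le> x \<Longrightarrow> x < y \<Longrightarrow> a x < a y"
  by (rule strict_mono_onD[OF Kinf_strict_mono]) auto

lemma Kinf_le: "class_Kinf a \<Longrightarrow> 0 \<le> x \<Longrightarrow> x \<le> y \<Longrightarrow> a x \<le> a y"
  using Kinf_less[of a x y] by (cases "x = y") auto

lemma Kinf_le_iff: "class_Kinf a \<Longrightarrow> 0 \<le> x \<Longrightarrow> 0 \<le> y \<Longrightarrow> a x \<le> a y \<longleftrightarrow> x \<le> y"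
  using Kinf_less[of a y x] Kinf_le[of a x y] by force

lemma Kinf_nonneg: "class_Kinf a \<Longrightarrow> 0 \<le> x \<Longrightarrow> 0 \<le> a x"
  using Kinf_le[of a 0 x] by (simp add: Kinf_zero)

lemma Kinf_pos: "class_Kinf a \<Longrightarrow> 0 < x \<Longrightarrow> 0 < a x"
  using Kinf_less[of a 0 x] by (simp add: Kinf_zero)

lemma Kinf_unbounded:
  assumes "class_Kinf a"
  obtains s where "0 \<le> s" "M < a s"
  using assms by (auto simp: class_Kinf_def)

lemma Kinf_image:
  assumes "class_Kinf a"
  shows "a ` {0..} = {0..}"
proof (intro equalityI subsetI)
  fix y assume "y \<in> a ` {0..}"
  then show "y \<in> {0..}"
    using Kinf_nonneg[OF assms] by auto
next
  fix y :: real assume y: "y \<in> {0..}"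
  obtain s where s: "0 \<le> s" "y < a s"
    using Kinf_unbounded[OF assms] .
  have "\<exists>x\<ge>0. x \<le> s \<and> a x = y"
    using y s Kinf_zero[OF assms]
    by (intro IVT') (auto intro: continuous_on_subset[OF Kinf_continuous[OF assms]])
  then show "y \<in> a ` {0..}" by auto
qed

text \<open>Extending \<open>g\<close> by the identity on the negative numbers gives a monotone
  surjection of the whole line. A jump of a monotone function would leave a gap in its range, so the
  extension is continuous.\<close>

lemma continuous_on_mono_onto:
  fixes g :: "real \<Rightarrow> real"
  assumes mono: "mono_on {0..} g" and onto: "g ` {0..} = {0..}"
  shows "continuous_on {0..} g"
proof -
  define G where "G x = (if x < 0 then x else g x)" for x
  have nonneg: "0 \<le> g x" if "0 \<le> x" for x
    using onto that by auto
  have "y \<in> range G" for y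
  proof (cases "y < 0")
    case True
    then have "y = G y" by (simp add: G_def)
    then show ?thesis by blast
  next
    case False
    then have "y \<in> g ` {0..}" unfolding onto by simp
    then obtain x where "0 \<le> x" "y = g x" by auto
    then have "y = G x" by (simp add: G_def)
    then show ?thesis by blast
  qed
  then have "range G = UNIV" by blast
  then have "continuous_on UNIV G"
    using nonneg mono_onD[OF mono]
    by (intro continuous_onI_mono) (auto simp: G_def intro: order.trans[of _ 0])
  then have "continuous_on {0..} G" by (rule continuous_on_subset) simp
  then show ?thesis
    by (rule continuous_on_eq) (simp add: G_def)
qed

text \<open>Continuity and unboundedness both follow from surjectivity. Inverses and compositions
  inherit strict monotonicity and surjectivity directly, so they need no separate continuity
  argument.\<close>

lemma KinfI_onto:
  assumes smono: "strict_mono_on {0..} a" and onto: "a ` {0..} = {0..}"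
  shows "class_Kinf a"
proof -
  have "mono_on {0..} a"
    using smono by (rule strict_mono_on_imp_mono_on)
  moreover obtain z where z: "0 \<le> z" "a z = 0"
    using onto by (metis (no_types, lifting) atLeast_iff imageE order_refl)
  have "a 0 \<le> a z"
    using \<open>mono_on {0..} a\<close> z(1) by (auto elim: mono_onD)
  moreover have "a 0 \<ge> 0" using onto by auto
  moreover have "\<exists>s\<ge>0. M < a s" for M
  proof -
    have "max 0 M + 1 \<in> a ` {0..}" unfolding onto by simp
    then obtain s where "max 0 M + 1 = a s" "0 \<le> s" by auto
    then show ?thesis by (intro exI[of _ s]) auto
  qed
  ultimately show ?thesis
    using smono z continuous_on_mono_onto[OF _ onto] by (auto simp: class_Kinf_def)
qed

lemma Kinf_inv:
  assumes "class_Kinf a" "0 \<le> y"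
  shows inv0_nonneg: "0 \<le> inv0 a y" and Kinf_inv0: "a (inv0 a y) = y"
proof -
  have "y \<in> a ` {0..}" using assms Kinf_image by auto
  then show "0 \<le> inv0 a y" "a (inv0 a y) = y"
    using inv_into_into[of y a "{0..}"] f_inv_into_f[of y a "{0..}"] by auto
qed

lemma inv0_Kinf: "class_Kinf a \<Longrightarrow> 0 \<le> x \<Longrightarrow> inv0 a (a x) = x"
  by (intro inv_into_f_f strict_mono_on_imp_inj_on Kinf_strict_mono) auto

lemma Kinf_inverse:
  assumes "class_Kinf a"
  shows "class_Kinf (inv0 a)"
proof (rule KinfI_onto)
  show "strict_mono_on {0..} (inv0 a)"
  proof (rule strict_mono_onI)
    fix r s :: real assume "r \<in> {0..}" "s \<in> {0..}" "r < s"
    then show "inv0 a r < inv0 a s"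
      using Kinf_le_iff[OF assms, of "inv0 a s" "inv0 a r"] Kinf_inv[OF assms] by force
  qed
  have "x \<in> inv0 a ` {0..}" if "0 \<le> x" for x
    using inv0_Kinf[OF assms that] Kinf_nonneg[OF assms that]
    by (metis atLeast_iff imageI)
  then show "inv0 a ` {0..} = {0..}"
    using inv0_nonneg[OF assms] by auto
qed

lemma Kinf_comp:
  assumes "class_Kinf a" "class_Kinf b"
  shows "class_Kinf (\<lambda>s. a (b s))"
proof (rule KinfI_onto)
  show "strict_mono_on {0..} (\<lambda>s. a (b s))"
    by (intro strict_mono_onI Kinf_less[OF assms(1)] Kinf_less[OF assms(2)]
        Kinf_nonneg[OF assms(2)]) auto
  have "(\<lambda>s. a (b s)) ` {0..} = a ` b ` {0..}" by auto
  then show "(\<lambda>s. a (b s)) ` {0..} = {0..}"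
    using assms by (simp add: Kinf_image)
qed

text \<open>The second summand is only nondecreasing, because it will be built from
  \<open>aWb\<close>, which may be constant on intervals; strictness comes from \<open>a\<close>
  alone.\<close>

lemma Kinf_add:
  assumes a: "class_Kinf a"
    and b: "continuous_on {0..} b" "mono_on {0..} b" "b 0 = 0"
  shows "class_Kinf (\<lambda>s. a s + b s)"
proof -
  have b_nonneg: "0 \<le> b s" if "0 \<le> s" for s
    using mono_onD[OF b(2), of 0 s] that b(3) by auto
  have "\<exists>s\<ge>0. M < a s + b s" for M
  proof -
    obtain s where "0 \<le> s" "M < a s" using Kinf_unbounded[OF a] .
    then show ?thesis using b_nonneg[of s] by (intro exI[of _ s]) auto
  qed
  moreover have "strict_mono_on {0..} (\<lambda>s. a s + b s)"
    by (rule strict_mono_onI)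
      (auto intro!: add_less_le_mono Kinf_less[OF a] mono_onD[OF b(2)])
  ultimately show ?thesis
    using b(1,3) by (auto simp: class_Kinf_def Kinf_zero[OF a] Kinf_continuous[OF a]
        intro!: continuous_on_add)
qed

lemma Kinf_mono_on: "class_Kinf a \<Longrightarrow> mono_on {0..} a"
  by (intro strict_mono_on_imp_mono_on Kinf_strict_mono)

lemma Kinf_plus: "class_Kinf a \<Longrightarrow> class_Kinf b \<Longrightarrow> class_Kinf (\<lambda>s. a s + b s)"
  by (rule Kinf_add[OF _ Kinf_continuous Kinf_mono_on Kinf_zero])

lemma Kinf_scale:
  assumes "0 < c"
  shows "class_Kinf (\<lambda>s. c * s)"
proof (rule KinfI_onto)
  show "strict_mono_on {0..} (\<lambda>s. c * s)"
    using assms by (auto intro: strict_mono_onI)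
  have "x \<in> (\<lambda>s. c * s) ` {0..}" if "0 \<le> x" for x
    using assms that by (intro image_eqI[of _ _ "x / c"]) auto
  then show "(\<lambda>s. c * s) ` {0..} = {0..}"
    using assms by auto
qed

lemma Kinf_id: "class_Kinf (\<lambda>s. s)"
  using Kinf_scale[of 1] by simp

lemma Kinf_cmult: "0 < c \<Longrightarrow> class_Kinf a \<Longrightarrow> class_Kinf (\<lambda>s. c * a s)"
  by (rule Kinf_comp[OF Kinf_scale])

lemma Kinf_mult_id:
  assumes "class_Kinf a"
  shows "class_Kinf (\<lambda>s. a s * s)"
proof -
  have "\<exists>s\<ge>0. M < a s * s" for M
  proof -
    obtain s where s: "0 \<le> s" "max 0 M < a s" using Kinf_unbounded[OF assms] .
    \<comment> \<open>Moving from \<open>s\<close> to \<open>s + 1\<close> makes the second factor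
      at least 1, so the product inherits the unboundedness of \<open>a\<close>.\<close>
    have "a s * 1 \<le> a (s + 1) * (s + 1)"
      using s by (intro mult_mono Kinf_le[OF assms]) (auto intro: Kinf_nonneg[OF assms])
    then show ?thesis using s by (intro exI[of _ "s + 1"]) auto
  qed
  moreover have "strict_mono_on {0..} (\<lambda>s. a s * s)"
  proof (rule strict_mono_onI)
    fix r s :: real assume rs: "r \<in> {0..}" "s \<in> {0..}" "r < s"
    then show "a r * r < a s * s"
      by (intro mult_strict_mono Kinf_less[OF assms] Kinf_nonneg[OF assms] Kinf_pos[OF assms]) auto
  qed
  ultimately show ?thesis
    by (auto simp: class_Kinf_def Kinf_continuous[OF assms] intro!: continuous_intros)
qed

lemma Kinf_min:
  assumes "class_Kinf a" "class_Kinf b"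
  shows "class_Kinf (\<lambda>s. min (a s) (b s))"
proof -
  have "\<exists>s\<ge>0. M < min (a s) (b s)" for M
  proof -
    obtain s t where "0 \<le> s" "M < a s" "0 \<le> t" "M < b t"
      using Kinf_unbounded[OF assms(1)] Kinf_unbounded[OF assms(2)] by metis
    then show ?thesis
      using Kinf_le[OF assms(1), of s "max s t"] Kinf_le[OF assms(2), of t "max s t"]
      by (intro exI[of _ "max s t"]) auto
  qed
  moreover have "strict_mono_on {0..} (\<lambda>s. min (a s) (b s))"
  proof (rule strict_mono_onI)
    fix r s :: real assume "r \<in> {0..}" "s \<in> {0..}" "r < s"
    then show "min (a r) (b r) < min (a s) (b s)"
      using Kinf_less[OF assms(1), of r s] Kinf_less[OF assms(2), of r s] by auto
  qed
  ultimately show ?thesis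
    using assms by (auto simp: class_Kinf_def intro!: continuous_on_min)
qed

section \<open>Integrals of class K-infinity functions, which become the weights \<rho> of the
  Lyapunov function\<close>

lemma Kinf_integrable: "class_Kinf q \<Longrightarrow> 0 \<le> a \<Longrightarrow> q integrable_on {a..b}"
  by (rule integrable_continuous_real) (auto intro: continuous_on_subset[OF Kinf_continuous])

lemma Kinf_integral_diff:
  assumes q: "class_Kinf q" and "0 \<le> a" "a \<le> b"
  shows "integral {0..b} q - integral {0..a} q = integral {a..b} q"
  using Henstock_Kurzweil_Integration.integral_combine[of 0 a b q] Kinf_integrable[OF q] assms
  by auto

lemma Kinf_integral_lower:
  assumes q: "class_Kinf q" and ab: "0 \<le> a" "a \<le> b"
  shows "q a * (b - a) \<le> integral {a..b} q"
proof -
  have "integral {a..b} (\<lambda>x. q a) \<le> integral {a..b} q"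
    using ab by (intro integral_le Kinf_integrable[OF q]) (auto intro: Kinf_le[OF q])
  then show ?thesis using ab by (simp add: mult.commute)
qed

lemma Kinf_integral_upper:
  assumes q: "class_Kinf q" and ab: "0 \<le> a" "a \<le> b"
  shows "integral {a..b} q \<le> q b * (b - a)"
proof -
  have "integral {a..b} q \<le> integral {a..b} (\<lambda>x. q b)"
    using ab by (intro integral_le Kinf_integrable[OF q]) (auto intro: Kinf_le[OF q])
  then show ?thesis using ab by (simp add: mult.commute)
qed

text \<open>This is the tangent inequality at \<open>b\<close> for the convex function with
  derivative \<open>q\<close>. It covers both orders of \<open>a\<close> and \<open>b\<close>, since
  the sign of \<open>b - a\<close> reverses the estimate of the integral as well.\<close>

lemma Kinf_integral_convex:
  assumes q: "class_Kinf q" and "0 \<le> a" "0 \<le> b"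
  shows "integral {0..b} q - integral {0..a} q \<le> q b * (b - a)"
proof (cases "a \<le> b")
  case True
  then show ?thesis
    using Kinf_integral_upper[OF q] Kinf_integral_diff[OF q] assms by simp
next
  case False
  then have "integral {0..a} q - integral {0..b} q \<ge> q b * (a - b)"
    using Kinf_integral_lower[OF q, of b a] Kinf_integral_diff[OF q, of b a] assms by simp
  then show ?thesis by (simp add: algebra_simps)
qed

text \<open>The interval from \<open>b\<close> to \<open>a\<close> is cut at
  \<open>a - d / 2\<close>. Since \<open>b\<close> is nonnegative, this point is at least
  \<open>d / 2\<close>, so \<open>q\<close> is at least \<open>q (d / 2)\<close> on the last piece
  of length \<open>d / 2\<close>; the first piece contributes a nonnegative amount.\<close>

lemma Kinf_integral_drop:
  assumes q: "class_Kinf q" and "0 \<le> d" "0 \<le> b" "b + d \<le> a"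
  shows "integral {0..b} q + q (d / 2) * (d / 2) \<le> integral {0..a} q"
proof -
  have "q (d / 2) * (d / 2) \<le> q (a - d / 2) * (a - (a - d / 2))"
    using assms by (auto intro!: mult_mono Kinf_le[OF q] Kinf_nonneg[OF q])
  also have "\<dots> \<le> integral {0..a} q - integral {0..a - d / 2} q"
    using assms Kinf_integral_diff[OF q, of "a - d / 2" a]
      Kinf_integral_lower[OF q, of "a - d / 2" a] by simp
  finally have 1: "q (d / 2) * (d / 2) \<le> integral {0..a} q - integral {0..a - d / 2} q" .
  have "0 \<le> q b * (a - d / 2 - b)"
    using assms by (auto intro!: mult_nonneg_nonneg Kinf_nonneg[OF q])
  also have "\<dots> \<le> integral {0..a - d / 2} q - integral {0..b} q"
    using assms Kinf_integral_diff[OF q, of b "a - d / 2"]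
      Kinf_integral_lower[OF q, of b "a - d / 2"] by simp
  finally show ?thesis using 1 by simp
qed

lemma Kinf_integral:
  assumes q: "class_Kinf q"
  shows "class_Kinf (\<lambda>s. integral {0..s} q)"
proof -
  have "continuous (at x within {0..}) (\<lambda>s. integral {0..s} q)" if "0 \<le> x" for x
  proof -
    have "continuous_on {0..x + 1} (\<lambda>s. integral {0..s} q)"
      by (rule indefinite_integral_continuous_1) (rule Kinf_integrable[OF q order_refl])
    \<comment> \<open>Continuity of the indefinite integral is available on compact intervals; near
      \<open>x\<close> the interval up to \<open>x + 1\<close> is indistinguishable from the
      half-line.\<close>
    moreover have "at x within {0..x + 1} = at x within {0..}"
      by (rule at_within_nhd[of _ "{..<x + 1}"]) auto
    ultimately show ?thesis
      using that by (auto simp: continuous_on_eq_continuous_within dest!: bspec[of _ _ x])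
  qed
  then have "continuous_on {0..} (\<lambda>s. integral {0..s} q)"
    by (simp add: continuous_on_eq_continuous_within)
  moreover have less: "integral {0..r} q < integral {0..s} q" if "0 \<le> r" "r < s" for r s
  proof -
    have "0 < q ((s - r) / 2) * ((s - r) / 2)"
      using that by (intro mult_pos_pos Kinf_pos[OF q]) auto
    then show ?thesis
      using Kinf_integral_drop[OF q, of "s - r" r s] that by simp
  qed
  moreover have "\<exists>s\<ge>0. M < integral {0..s} q" for M
  proof -
    obtain s where s: "0 \<le> s" "max 0 M < q s" using Kinf_unbounded[OF q] .
    have "integral {0..0} q \<le> integral {0..s} q"
      using less[of 0 s] s by (cases "s = 0") auto
    then have "M < integral {0..s + 1} q"
      using Kinf_integral_diff[OF q, of s "s + 1"] Kinf_integral_lower[OF q, of s "s + 1"] s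
      by simp
    then show ?thesis using s by (intro exI[of _ "s + 1"]) auto
  qed
  ultimately show ?thesis
    by (auto simp: class_Kinf_def intro: strict_mono_onI)
qed


section \<open>Iterates with running maximum\<close>

lemma image_interval_from_zero:
  fixes g :: "real \<Rightarrow> real"
  assumes "continuous_on {0..} g" and bounds: "\<And>r. 0 \<le> r \<Longrightarrow> 0 \<le> g r \<and> g r \<le> r"
    and "0 \<le> c"
  shows "\<exists>d. 0 \<le> d \<and> d \<le> c \<and> g ` {0..c} = {0..d}"
proof -
  have "continuous_on {0..c} g"
    using assms(1) by (rule continuous_on_subset) simp
  then obtain e d where ed: "g ` {0..c} = {e..d}" "e \<le> d"
    using continuous_image_closed_interval[OF \<open>0 \<le> c\<close>] by blast
  have "g 0 = 0" using bounds[of 0] by simp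
  then have "0 \<in> {e..d}"
    unfolding ed(1)[symmetric] using \<open>0 \<le> c\<close> by (auto intro!: image_eqI[of _ _ 0])
  moreover have "e \<in> g ` {0..c}" "d \<in> g ` {0..c}" unfolding ed(1) using ed(2) by auto
  then obtain x y where "0 \<le> x" "e = g x" "0 \<le> y" "y \<le> c" "d = g y" by auto
  then have "0 \<le> e" "d \<le> c" using bounds[of x] bounds[of y] by simp_all
  ultimately show ?thesis using ed by (intro exI[of _ d]) auto
qed

locale decrement =
  fixes a :: "real \<Rightarrow> real"
  assumes a_Kinf: "class_Kinf a"
begin

text \<open>The truncated map is used in both branches of \<open>id_minus_iter\<close>, so that all
  later arguments avoid the case distinction on monotonicity.\<close>

definition g :: "real \<Rightarrow> real" where
  "g r = max 0 (r - a r)"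

lemma g_bounds: "0 \<le> r \<Longrightarrow> 0 \<le> g r \<and> g r \<le> r"
  using Kinf_nonneg[OF a_Kinf, of r] by (auto simp: g_def)

lemma g_continuous: "continuous_on {0..} g"
  unfolding g_def by (intro continuous_intros Kinf_continuous[OF a_Kinf])

lemma iter_bounds: "0 \<le> r \<Longrightarrow> 0 \<le> (g ^^ k) r \<and> (g ^^ k) r \<le> r"
  by (induction k) (use g_bounds order.trans in fastforce)+

text \<open>If \<open>r - a r\<close> is nondecreasing, it is at least its value 0 at 0, so the
  truncation is inactive; the iterates are then nondecreasing and their supremum over the interval
  is the value at \<open>s\<close>.\<close>

lemma id_minus_iter_eq_SUP:
  assumes "0 \<le> s"
  shows "id_minus_iter a k s = (SUP t\<in>{0..s}. (g ^^ k) t)"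
proof (cases "mono_on {0..} (\<lambda>r. r - a r)")
  case True
  have g_eq: "r - a r = g r" if "0 \<le> r" for r
    using mono_onD[OF True, of 0 r] that by (simp add: g_def Kinf_zero[OF a_Kinf])
  have iter_eq: "((\<lambda>r. r - a r) ^^ k) r = (g ^^ k) r" if "0 \<le> r" for r k
    by (induction k) (use iter_bounds[OF that] g_eq in simp_all)
  have iter_mono: "(g ^^ k) t \<le> (g ^^ k) s" if "0 \<le> t" "t \<le> s" for t
  proof (induction k)
    case (Suc k)
    then show ?case
      using mono_onD[OF True, of "(g ^^ k) t" "(g ^^ k) s"] iter_bounds[of t k]
        iter_bounds[of s k] that g_eq by simp
  qed (use that in simp)
  have "(SUP t\<in>{0..s}. (g ^^ k) t) = (g ^^ k) s"
    using assms by (intro cSup_eq_maximum) (auto intro: iter_mono)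
  then show ?thesis
    using True iter_eq[OF assms] by (simp add: id_minus_iter_def)
next
  case False
  then show ?thesis by (simp add: id_minus_iter_def g_def[abs_def])
qed

text \<open>By continuity and \<open>g 0 = 0\<close> the images stay intervals starting at 0, so the
  running maximum is exactly the right endpoint of the image.\<close>

lemma iter_image:
  assumes "0 \<le> s"
  shows "0 \<le> id_minus_iter a k s \<and> (g ^^ k) ` {0..s} = {0..id_minus_iter a k s}"
proof -
  have "\<exists>c\<ge>0. (g ^^ k) ` {0..s} = {0..c}"
  proof (induction k)
    case (Suc k)
    then obtain c where c: "0 \<le> c" "(g ^^ k) ` {0..s} = {0..c}" by blast
    obtain d where "0 \<le> d" "g ` {0..c} = {0..d}"
      using image_interval_from_zero[OF g_continuous g_bounds c(1)] by blast
    moreover have "(g ^^ Suc k) ` {0..s} = g ` (g ^^ k) ` {0..s}"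
      by (simp add: image_comp)
    ultimately show ?case using c by metis
  qed (use assms in auto)
  then show ?thesis
    by (metis id_minus_iter_eq_SUP[OF assms] cSup_atLeastAtMost)
qed

text \<open>The running maxima need not satisfy a recursion under \<open>g\<close>, but the
  intervals they bound do; this replaces monotonicity of \<open>g\<close> in what follows.\<close>

lemma iter_Suc_image:
  assumes "0 \<le> s"
  shows "g ` {0..id_minus_iter a k s} = {0..id_minus_iter a (Suc k) s}"
proof -
  have "(g ^^ Suc k) ` {0..s} = g ` (g ^^ k) ` {0..s}"
    by (simp add: image_comp)
  then show ?thesis using iter_image[OF assms] by metis
qed

lemma iter_nonneg: "0 \<le> s \<Longrightarrow> 0 \<le> id_minus_iter a k s"
  using iter_image by blast

lemma iter_0: "0 \<le> s \<Longrightarrow> id_minus_iter a 0 s = s"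
  using iter_image[of s 0] by auto

lemma iter_mono:
  assumes "0 \<le> s" "s \<le> t"
  shows "id_minus_iter a k s \<le> id_minus_iter a k t"
proof -
  have "{0..id_minus_iter a k s} \<subseteq> {0..id_minus_iter a k t}"
    using iter_image[of s k] iter_image[of t k] assms image_mono[of "{0..s}" "{0..t}" "g ^^ k"]
    by auto
  then show ?thesis using iter_nonneg[OF assms(1)] by auto
qed

lemma iter_preimage:
  assumes "0 \<le> s"
  obtains r where "0 \<le> r" "r \<le> id_minus_iter a k s" "id_minus_iter a (Suc k) s = g r"
proof -
  have "id_minus_iter a (Suc k) s \<in> g ` {0..id_minus_iter a k s}"
    unfolding iter_Suc_image[OF assms] using iter_nonneg[OF assms] by simp
  then show ?thesis using that by auto
qed

lemma iter_decseq:
  assumes "0 \<le> s"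
  shows "decseq (\<lambda>k. id_minus_iter a k s)"
proof (rule decseq_SucI)
  fix k
  obtain r where "0 \<le> r" "r \<le> id_minus_iter a k s" "id_minus_iter a (Suc k) s = g r"
    using iter_preimage[OF assms] .
  then show "id_minus_iter a (Suc k) s \<le> id_minus_iter a k s"
    using g_bounds[of r] by simp
qed

lemma iter_le: "0 \<le> s \<Longrightarrow> id_minus_iter a k s \<le> s"
  using decseqD[OF iter_decseq, of s 0 k] iter_0 by simp

text \<open>Let \<open>L\<close> be the limit of the decreasing maxima. The preimages
  \<open>r k\<close> satisfy \<open>L <= ?M (Suc k) = g (r k) <= r k <= ?M k\<close>, so they also
  tend to \<open>L\<close>. Continuity makes \<open>L\<close> a fixed point of \<open>g\<close>, and
  positivity of \<open>a\<close> away from 0 leaves only \<open>L = 0\<close>.\<close>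

lemma iter_tendsto_zero:
  assumes "0 \<le> s"
  shows "(\<lambda>k. id_minus_iter a k s) \<longlonglongrightarrow> 0"
proof -
  let ?M = "\<lambda>k. id_minus_iter a k s"
  obtain L where L: "?M \<longlonglongrightarrow> L" "\<And>k. L \<le> ?M k"
    using decseq_convergent[OF iter_decseq[OF assms], of 0] iter_nonneg[OF assms] by blast
  have "0 \<le> L"
    using L(1) iter_nonneg[OF assms] by (intro LIMSEQ_le_const) auto
  have "\<exists>r. \<forall>k. 0 \<le> r k \<and> r k \<le> ?M k \<and> ?M (Suc k) = g (r k)"
    using iter_preimage[OF assms] by (intro choice) metis
  then obtain r where r: "\<And>k. 0 \<le> r k" "\<And>k. r k \<le> ?M k" "\<And>k. ?M (Suc k) = g (r k)"
    by blast
  have "L \<le> r k" for k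
    using L(2)[of "Suc k"] r(3)[of k] g_bounds[OF r(1)[of k]] by simp
  then have "r \<longlonglongrightarrow> L"
    using r(2) L(1) by (intro tendsto_sandwich[of "\<lambda>_. L" r _ ?M]) auto
  then have "(\<lambda>k. g (r k)) \<longlonglongrightarrow> g L"
    using r(1) \<open>0 \<le> L\<close> by (intro continuous_on_tendsto_compose[OF g_continuous]) auto
  moreover have "(\<lambda>k. g (r k)) \<longlonglongrightarrow> L"
    using LIMSEQ_Suc[OF L(1)] by (simp add: r(3))
  ultimately have "g L = L" by (rule LIMSEQ_unique)
  then have "L = 0"
    using Kinf_pos[OF a_Kinf, of L] \<open>0 \<le> L\<close>
    by (cases "L = 0") (auto simp: g_def max_def split: if_splits)
  then show ?thesis using L(1) by simp
qed

text \<open>In the non-monotone case the induction works because every value in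
  \<open>[0, id_minus_iter a k s]\<close> is attained by the \<open>k\<close>-th iterate on \<open>[0, s]\<close>.\<close>

lemma iter_comparison:
  assumes nonneg: "\<And>k. 0 \<le> y k" and step: "\<And>k. y (Suc k) \<le> y k - a (y k)" and "y 0 \<le> s"
  shows "y k \<le> id_minus_iter a k s"
proof -
  have s: "0 \<le> s" using nonneg[of 0] assms(3) by simp
  show ?thesis
  proof (induction k)
    case 0
    then show ?case using iter_0[OF s] assms(3) by simp
  next
    case (Suc k)
    then have "g (y k) \<in> g ` {0..id_minus_iter a k s}"
      using nonneg by auto
    then have "g (y k) \<le> id_minus_iter a (Suc k) s"
      unfolding iter_Suc_image[OF s] by simp
    then show ?case using step[of k] by (simp add: g_def)
  qed
qed

lemma KL_iter:
  assumes lo: "class_Kinf lo" and up: "class_Kinf up"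
  shows "class_KL (\<lambda>s k. inv0 lo (id_minus_iter a k (up s)))"
proof -
  note inv = Kinf_inverse[OF lo]
  have nonneg: "0 \<le> inv0 lo (id_minus_iter a k (up s))" if "0 \<le> s" for s k
    using that by (intro Kinf_nonneg[OF inv] iter_nonneg Kinf_nonneg[OF up])
  have "mono_on {0..} (\<lambda>s. inv0 lo (id_minus_iter a k (up s)))" for k
    by (rule mono_onI)
      (auto intro!: Kinf_le[OF inv] iter_mono iter_nonneg Kinf_nonneg[OF up] Kinf_le[OF up])
  moreover have "((\<lambda>s. inv0 lo (id_minus_iter a k (up s))) \<longlongrightarrow> 0) (at_right 0)" for k
  proof (rule tendsto_sandwich)
    show "\<forall>\<^sub>F s in at_right 0. 0 \<le> inv0 lo (id_minus_iter a k (up s))"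
      by (auto intro!: eventually_at_rightI[of 0 1] nonneg)
    \<comment> \<open>The iterates never exceed their argument, so \<open>inv0 lo (up s)\<close>
      dominates for every \<open>k\<close>, and it is continuous and zero at zero.\<close>
    show "\<forall>\<^sub>F s in at_right 0. inv0 lo (id_minus_iter a k (up s)) \<le> inv0 lo (up s)"
      by (auto intro!: eventually_at_rightI[of 0 1] Kinf_le[OF inv] iter_nonneg iter_le Kinf_nonneg[OF up])
    have "continuous_on {0..} (\<lambda>s. inv0 lo (up s))"
      by (rule Kinf_continuous[OF Kinf_comp[OF inv up]])
    then have "((\<lambda>s. inv0 lo (up s)) \<longlongrightarrow> inv0 lo (up 0)) (at 0 within {0..})"
      by (simp add: continuous_on_def)
    then show "((\<lambda>s. inv0 lo (up s)) \<longlongrightarrow> 0) (at_right 0)"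
      by (auto simp: Kinf_zero[OF inv] Kinf_zero[OF up] intro: tendsto_within_subset)
  qed simp
  moreover have "antimono (\<lambda>k. inv0 lo (id_minus_iter a k (up s)))" if "0 \<le> s" for s
    using that iter_decseq[OF Kinf_nonneg[OF up that]]
    by (intro antimonoI Kinf_le[OF inv] iter_nonneg Kinf_nonneg[OF up])
      (auto simp: decseq_def)
  moreover have "(\<lambda>k. inv0 lo (id_minus_iter a k (up s))) \<longlonglongrightarrow> 0" if "0 \<le> s" for s
  proof -
    have "(\<lambda>k. inv0 lo (id_minus_iter a k (up s))) \<longlonglongrightarrow> inv0 lo 0"
      using Kinf_nonneg[OF up that]
      by (intro continuous_on_tendsto_compose[OF Kinf_continuous[OF inv]] iter_tendsto_zero)
        (simp_all add: iter_nonneg)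
    then show ?thesis by (simp add: Kinf_zero[OF inv])
  qed
  ultimately show ?thesis using nonneg by (auto simp: class_KL_def)
qed

end


section \<open>The Lyapunov function\<close>

locale Lyapunov_bounds =
  fixes aW aWb cW aVb :: "real \<Rightarrow> real"
  assumes aW: "class_Kinf aW" and cW: "class_Kinf cW" and aVb: "class_Kinf aVb"
    and aWb_cont: "continuous_on {0..} aWb" and aWb_mono: "mono_on {0..} aWb"
    and aWb_zero: "aWb 0 = 0"
begin

text \<open>\<open>theta c\<close> bounds the value of \<open>W\<close> after a step whose stage
  cost \<open>c\<close> is large compared with \<open>aW s\<close>; \<open>q_W\<close> is half its
  inverse, so there \<open>q_W\<close> is at most \<open>c / 2\<close>.\<close>

definition theta :: "real \<Rightarrow> real" where
  "theta r = cW r + (aWb (inv0 aW (2 * cW r)) + inv0 aW (2 * cW r))"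

lemma aWb_nonneg: "0 \<le> s \<Longrightarrow> 0 \<le> aWb s"
  using mono_onD[OF aWb_mono, of 0 s] aWb_zero by simp

lemma Kinf_inv_aW_2cW: "class_Kinf (\<lambda>r. inv0 aW (2 * cW r))"
  by (rule Kinf_comp[OF Kinf_inverse[OF aW] Kinf_cmult[OF _ cW]]) simp

lemma Kinf_theta: "class_Kinf theta"
proof -
  have "class_Kinf (\<lambda>s. s + aWb s)"
    by (rule Kinf_add[OF Kinf_id aWb_cont aWb_mono aWb_zero])
  then have "class_Kinf (\<lambda>r. cW r + (inv0 aW (2 * cW r) + aWb (inv0 aW (2 * cW r))))"
    by (rule Kinf_plus[OF cW Kinf_comp[OF _ Kinf_inv_aW_2cW]])
  then show ?thesis by (simp add: theta_def[abs_def] add.commute)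
qed

lemma q_W_eq: "q_W aW aWb cW = (\<lambda>s. 1/2 * inv0 theta s)"
  by (simp add: q_W_def theta_def[abs_def] fun_eq_iff)

lemma Kinf_q_W: "class_Kinf (q_W aW aWb cW)"
  unfolding q_W_eq by (rule Kinf_cmult[OF _ Kinf_inverse[OF Kinf_theta]]) simp

lemma Kinf_q_V: "class_Kinf (q_V cW)"
  unfolding q_V_def[abs_def] by (rule Kinf_cmult[OF _ Kinf_comp[OF cW Kinf_scale]]) simp_all

lemma Kinf_rho_V: "class_Kinf (rho_V cW)"
  unfolding rho_V_def[abs_def] by (rule Kinf_integral[OF Kinf_q_V])

lemma Kinf_rho_W: "class_Kinf (rho_W aW aWb cW)"
  unfolding rho_W_def[abs_def] by (rule Kinf_integral[OF Kinf_q_W])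

lemma Kinf_alpha_Y: "class_Kinf (alpha_Y aW aWb cW)"
proof (cases "below_id cW")
  case True
  then show ?thesis using aW by (simp add: alpha_Y_def[abs_def])
next
  case False
  have "class_Kinf (\<lambda>s. q_W aW aWb cW (1/4 * aW s) * (1/4 * aW s))"
    by (rule Kinf_comp[OF Kinf_mult_id[OF Kinf_q_W] Kinf_cmult[OF _ aW]]) simp
  then show ?thesis using False by (simp add: alpha_Y_def[abs_def])
qed

lemma Kinf_upper_Y: "class_Kinf (upper_Y aW aWb cW aVb)"
proof (cases "below_id cW")
  case True
  have "class_Kinf (\<lambda>s. aVb s + aWb s)"
    by (rule Kinf_add[OF aVb aWb_cont aWb_mono aWb_zero])
  then show ?thesis using True by (simp add: upper_Y_def[abs_def])
next
  case False
  have "continuous_on {0..} (\<lambda>s. rho_W aW aWb cW (aWb s))"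
    by (rule continuous_on_compose2[OF Kinf_continuous[OF Kinf_rho_W] aWb_cont])
      (auto intro: aWb_nonneg)
  moreover have "mono_on {0..} (\<lambda>s. rho_W aW aWb cW (aWb s))"
    by (rule mono_onI) (auto intro!: Kinf_le[OF Kinf_rho_W] aWb_nonneg mono_onD[OF aWb_mono])
  moreover have "rho_W aW aWb cW (aWb 0) = 0"
    by (simp add: aWb_zero Kinf_zero[OF Kinf_rho_W])
  ultimately have "class_Kinf (\<lambda>s. rho_V cW (aVb s) + rho_W aW aWb cW (aWb s))"
    by (rule Kinf_add[OF Kinf_comp[OF Kinf_rho_V aVb]])
  then show ?thesis using False by (simp add: upper_Y_def[abs_def])
qed

lemma Kinf_lower_Y: "class_Kinf (lower_Y aW aWb cW)"
proof (cases "below_id cW")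
  case True
  then show ?thesis using aW by (simp add: lower_Y_def[abs_def])
next
  case False
  have "class_Kinf (\<lambda>s. 1/2 * aW s)" by (rule Kinf_cmult[OF _ aW]) simp
  then have "class_Kinf (\<lambda>s. min (rho_V cW (inv0 cW (1/2 * aW s))) (rho_W aW aWb cW (1/2 * aW s)))"
    by (intro Kinf_min Kinf_comp[OF Kinf_rho_V] Kinf_comp[OF Kinf_rho_W]
        Kinf_comp[OF Kinf_inverse[OF cW]])
  then show ?thesis using False by (simp add: lower_Y_def[abs_def])
qed

lemma Kinf_tilde_Y: "class_Kinf (tilde_Y aW aWb cW aVb)"
  unfolding tilde_Y_def[abs_def] by (rule Kinf_comp[OF Kinf_alpha_Y Kinf_inverse[OF Kinf_upper_Y]])

section \<open>Bounds and decrease of the Lyapunov function, for real values \<open>v\<close> of the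
  cost and \<open>w\<close> of \<open>W\<close>\<close>

definition Y :: "real \<Rightarrow> real \<Rightarrow> real" where
  "Y v w = (if below_id cW then v + w else rho_V cW v + rho_W aW aWb cW w)"

lemma Y_nonneg: "0 \<le> v \<Longrightarrow> 0 \<le> w \<Longrightarrow> 0 \<le> Y v w"
  by (simp add: Y_def Kinf_nonneg[OF Kinf_rho_V] Kinf_nonneg[OF Kinf_rho_W])

lemma Y_upper:
  assumes "0 \<le> v" "0 \<le> w" "v \<le> aVb s" "w \<le> aWb s"
  shows "Y v w \<le> upper_Y aW aWb cW aVb s"
  using assms by (auto simp: Y_def upper_Y_def
      intro!: add_mono Kinf_le[OF Kinf_rho_V] Kinf_le[OF Kinf_rho_W])

text \<open>One of \<open>w\<close> and \<open>cW v\<close> is at least half of \<open>aW s\<close>.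
  This explains the factor 1/2 and the minimum in \<open>lower_Y\<close>: it is not known which of
  the two it is.\<close>

lemma Y_lower:
  assumes nonneg: "0 \<le> v" "0 \<le> w" "0 \<le> s" and le: "aW s \<le> w + cW v"
  shows "lower_Y aW aWb cW s \<le> Y v w"
proof (cases "below_id cW")
  case True
  then have "cW v \<le> v" using nonneg by (simp add: below_id_def)
  then show ?thesis using True le by (simp add: lower_Y_def Y_def)
next
  case False
  have d: "0 \<le> 1/2 * aW s" using Kinf_nonneg[OF aW nonneg(3)] by simp
  have pos: "0 \<le> rho_V cW v" "0 \<le> rho_W aW aWb cW w"
    using nonneg by (simp_all add: Kinf_nonneg[OF Kinf_rho_V] Kinf_nonneg[OF Kinf_rho_W])
  consider "1/2 * aW s \<le> w" | "1/2 * aW s \<le> cW v" using le by linarith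
  then show ?thesis
  proof cases
    case 1
    then have "rho_W aW aWb cW (1/2 * aW s) \<le> rho_W aW aWb cW w"
      using d by (intro Kinf_le[OF Kinf_rho_W])
    then show ?thesis using False pos by (simp add: lower_Y_def Y_def)
  next
    case 2
    then have "inv0 cW (1/2 * aW s) \<le> v"
      using Kinf_le[OF Kinf_inverse[OF cW] d 2] inv0_Kinf[OF cW nonneg(1)] by simp
    then have "rho_V cW (inv0 cW (1/2 * aW s)) \<le> rho_V cW v"
      using d by (intro Kinf_le[OF Kinf_rho_V] inv0_nonneg[OF cW])
    then show ?thesis using False pos by (simp add: lower_Y_def Y_def)
  qed
qed

lemma Y_decrease:
  assumes nonneg: "0 \<le> c" "0 \<le> s" "0 \<le> v'" "0 \<le> w'" "0 \<le> w"
    and v: "c + v' \<le> v" and w: "w' \<le> w - aW s + cW c" and w_le: "w \<le> aWb s"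
  shows "Y v' w' \<le> Y v w - alpha_Y aW aWb cW s"
proof (cases "below_id cW")
  case True
  then have "cW c \<le> c" using nonneg by (simp add: below_id_def)
  then show ?thesis using True v w by (simp add: alpha_Y_def Y_def)
next
  case False
  define d where "d = aW s"
  have d: "0 \<le> d" unfolding d_def by (intro Kinf_nonneg[OF aW] nonneg)
  have cWc: "0 \<le> cW c" by (intro Kinf_nonneg[OF cW] nonneg)
  \<comment> \<open>The constants in \<open>q_V\<close> are made for this:
    \<open>q_V cW (c / 2) * (c / 2)\<close> equals \<open>cW c * c\<close>.\<close>
  have V: "rho_V cW v' + cW c * c \<le> rho_V cW v"
    using Kinf_integral_drop[OF Kinf_q_V, of c v' v] nonneg v
    by (simp add: rho_V_def q_V_def)
  have "rho_V cW v' + rho_W aW aWb cW w' + q_W aW aWb cW (d / 4) * (d / 4)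
        \<le> rho_V cW v + rho_W aW aWb cW w"
  proof (cases "cW c \<le> d / 2")
    case True
    \<comment> \<open>Here \<open>w\<close> drops by at least \<open>d / 2\<close>, and halving once
      more in \<open>Kinf_integral_drop\<close> yields the quarter in
      \<open>alpha_Y\<close>.\<close>
    have "rho_W aW aWb cW w' + q_W aW aWb cW (d / 4) * (d / 4) \<le> rho_W aW aWb cW w"
      using Kinf_integral_drop[OF Kinf_q_W, of "d / 2" w' w] nonneg d w True
      by (simp add: rho_W_def d_def)
    moreover have "0 \<le> cW c * c" using cWc nonneg by simp
    ultimately show ?thesis using V by simp
  next
    case large: False
    have s_le: "s \<le> inv0 aW (2 * cW c)"
      using Kinf_le[OF Kinf_inverse[OF aW], of "aW s" "2 * cW c"] inv0_Kinf[OF aW, of s]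
        nonneg(2) d large by (simp add: d_def)
    then have "aWb s \<le> aWb (inv0 aW (2 * cW c))"
      using nonneg by (intro mono_onD[OF aWb_mono]) auto
    then have theta_ge: "w' \<le> theta c" "cW c \<le> theta c"
      using w w_le s_le nonneg d aWb_nonneg[OF nonneg(2)] by (auto simp: theta_def d_def)
    have q_le: "q_W aW aWb cW r \<le> c / 2" if "0 \<le> r" "r \<le> theta c" for r
      using Kinf_le[OF Kinf_inverse[OF Kinf_theta] that] inv0_Kinf[OF Kinf_theta nonneg(1)]
      by (simp add: q_W_eq)
    \<comment> \<open>Now \<open>W\<close> may grow, but by at most \<open>cW c\<close>. The slope
      at \<open>w'\<close> is at most \<open>c / 2\<close>, so the growth of \<open>rho_W\<close>
      uses up at most half of the drop \<open>cW c * c\<close> of \<open>rho_V\<close>.\<close>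
    have "rho_W aW aWb cW w' - rho_W aW aWb cW w \<le> q_W aW aWb cW w' * (w' - w)"
      unfolding rho_W_def by (intro Kinf_integral_convex[OF Kinf_q_W] nonneg)
    also have "\<dots> \<le> q_W aW aWb cW w' * cW c"
      using w d by (intro mult_left_mono Kinf_nonneg[OF Kinf_q_W] nonneg) (simp add: d_def)
    also have "\<dots> \<le> c / 2 * cW c"
      by (intro mult_right_mono q_le nonneg theta_ge cWc)
    finally have W: "rho_W aW aWb cW w' - rho_W aW aWb cW w \<le> c / 2 * cW c" .
    \<comment> \<open>The other half of the drop pays for \<open>alpha_Y\<close>: in this case
      \<open>d / 4\<close> is below \<open>cW c / 2\<close>, hence below
      \<open>theta c\<close>.\<close>
    have "q_W aW aWb cW (d / 4) * (d / 4) \<le> c / 2 * (cW c / 2)"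
      using d large theta_ge cWc nonneg by (intro mult_mono q_le) auto
    also have "\<dots> \<le> c / 2 * cW c"
      using nonneg cWc by (intro mult_left_mono) auto
    finally show ?thesis using V W by (simp add: mult.commute)
  qed
  then show ?thesis using False by (simp add: Y_def alpha_Y_def d_def)
qed

sublocale decrement "tilde_Y aW aWb cW aVb"
  by standard (rule Kinf_tilde_Y)

lemma KL_beta_Y: "class_KL (beta_Y aW aWb cW aVb)"
  unfolding beta_Y_def[abs_def] by (rule KL_iter[OF Kinf_lower_Y Kinf_upper_Y])

text \<open>The stability argument is isolated for scalar sequences, so that policy iteration has to
  supply only these inequalities along a solution.\<close>

lemma beta_Y_bound:
  assumes nonneg: "\<And>k. 0 \<le> s k" "\<And>k. 0 \<le> v k" "\<And>k. 0 \<le> w k" "\<And>k. 0 \<le> c k"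
    and v_le: "\<And>k. v k \<le> aVb (s k)" and w_le: "\<And>k. w k \<le> aWb (s k)"
    and v_Suc: "\<And>k. c k + v (Suc k) \<le> v k"
    and w_Suc: "\<And>k. w (Suc k) \<le> w k - aW (s k) + cW (c k)"
  shows "s k \<le> beta_Y aW aWb cW aVb (s 0) k"
proof -
  let ?y = "\<lambda>k. Y (v k) (w k)"
  have upper: "?y k \<le> upper_Y aW aWb cW aVb (s k)" for k
    by (intro Y_upper nonneg v_le w_le)
  have y_nonneg: "0 \<le> ?y k" for k by (intro Y_nonneg nonneg)
  have "?y (Suc k) \<le> ?y k - tilde_Y aW aWb cW aVb (?y k)" for k
  proof -
    \<comment> \<open>Inverting the upper bound turns the decrease in terms of \<open>s k\<close>
      into one in terms of \<open>?y k\<close> itself, as the comparison lemma requires.\<close>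
    have "inv0 (upper_Y aW aWb cW aVb) (?y k) \<le> s k"
      using Kinf_le[OF Kinf_inverse[OF Kinf_upper_Y] y_nonneg upper]
      by (simp add: inv0_Kinf[OF Kinf_upper_Y nonneg(1)])
    then have "tilde_Y aW aWb cW aVb (?y k) \<le> alpha_Y aW aWb cW (s k)"
      unfolding tilde_Y_def
      by (intro Kinf_le[OF Kinf_alpha_Y] inv0_nonneg[OF Kinf_upper_Y] y_nonneg)
    moreover have "?y (Suc k) \<le> ?y k - alpha_Y aW aWb cW (s k)"
      by (intro Y_decrease[of "c k"] nonneg v_Suc w_Suc w_le)
    ultimately show ?thesis by simp
  qed
  then have y_le: "?y k \<le> id_minus_iter (tilde_Y aW aWb cW aVb) k (upper_Y aW aWb cW aVb (s 0))"
    by (intro iter_comparison y_nonneg upper)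
  have "cW (c k) \<le> cW (v k)"
    using v_Suc[of k] nonneg(2)[of "Suc k"] by (intro Kinf_le[OF cW] nonneg) simp
  \<comment> \<open>The lower bound on \<open>Y\<close> is a detectability property: it comes from
    dropping the nonnegative \<open>w (Suc k)\<close> in the dissipation inequality.\<close>
  then have "aW (s k) \<le> w k + cW (v k)"
    using w_Suc[of k] nonneg(3)[of "Suc k"] by simp
  then have "lower_Y aW aWb cW (s k) \<le> ?y k"
    by (intro Y_lower nonneg)
  with y_le show ?thesis
    using Kinf_le[OF Kinf_inverse[OF Kinf_lower_Y] Kinf_nonneg[OF Kinf_lower_Y nonneg(1)], of k
        "id_minus_iter (tilde_Y aW aWb cW aVb) k (upper_Y aW aWb cW aVb (s 0))"]
    by (simp add: beta_Y_def inv0_Kinf[OF Kinf_lower_Y nonneg(1)])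
qed

end


section \<open>Policy iteration\<close>

lemma policy_cost_unfold:
  "policy_cost f l h x = ennreal (l x (h x)) + policy_cost f l h (f x (h x))"
proof -
  let ?c = "\<lambda>k. ennreal (l (closed_loop f h k x) (h (closed_loop f h k x)))"
  have "suminf ?c = (\<Sum>k. ?c (Suc k)) + ?c 0"
    using suminf_offset[of ?c 1] by (simp add: add.commute)
  moreover have "closed_loop f h (Suc k) x = closed_loop f h k (f x (h x))" for k
    by (simp add: closed_loop_def funpow_Suc_right del: funpow.simps)
  moreover have "closed_loop f h 0 x = x"
    by (simp add: closed_loop_def)
  ultimately show ?thesis by (simp add: policy_cost_def add.commute)
qed

text \<open>Telescoping: every function satisfying the Bellman inequality for \<open>h\<close>
  dominates each partial sum of the cost plus its own value at the current state.\<close>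

lemma policy_cost_le:
  assumes "\<And>x. ennreal (l x (h x)) + V (f x (h x)) \<le> V x"
  shows "policy_cost f l h x \<le> V x"
proof -
  let ?S = "\<lambda>n. \<Sum>k<n. ennreal (l (closed_loop f h k x) (h (closed_loop f h k x)))"
  have sum_le: "?S n + V (closed_loop f h n x) \<le> V x" for n
  proof (induction n)
    case (Suc n)
    let ?z = "closed_loop f h n x"
    have "?S (Suc n) + V (closed_loop f h (Suc n) x) = ?S n + (ennreal (l ?z (h ?z)) + V (f ?z (h ?z)))"
      by (simp add: closed_loop_def add.assoc)
    also have "\<dots> \<le> ?S n + V ?z"
      by (rule add_left_mono[OF assms])
    also note Suc
    finally show ?case .
  qed (simp add: closed_loop_def)
  have "?S n \<le> V x" for n
    by (rule order.trans[OF _ sum_le[of n]]) simp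
  then show ?thesis
    unfolding policy_cost_def by (intro suminf_le_const) auto
qed

lemma PI_inputs_Suc_cost:
  assumes "u \<in> PI_inputs f U l h (Suc i) x" and "h i x \<in> U x"
  shows "u \<in> U x"
    and "ennreal (l x u) + policy_cost f l (h i) (f x u) \<le> policy_cost f l (h i) x"
proof -
  show "u \<in> U x" using assms by (simp add: PI_inputs_def is_arg_min_def)
  have "ennreal (l x u) + policy_cost f l (h i) (f x u)
      \<le> ennreal (l x (h i x)) + policy_cost f l (h i) (f x (h i x))"
    using assms by (auto simp: PI_inputs_def is_arg_min_def not_less)
  then show "ennreal (l x u) + policy_cost f l (h i) (f x u) \<le> policy_cost f l (h i) x"
    by (simp flip: policy_cost_unfold)
qed

theorem theorem1:
  fixes f :: "real ^ 'nx \<Rightarrow> real ^ 'nu \<Rightarrow> real ^ 'nx"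
    and U :: "real ^ 'nx \<Rightarrow> (real ^ 'nu) set"
    and l :: "real ^ 'nx \<Rightarrow> real ^ 'nu \<Rightarrow> real"
    and \<sigma> W :: "real ^ 'nx \<Rightarrow> real"
    and h0 :: "real ^ 'nx \<Rightarrow> real ^ 'nu"
    and h :: "nat \<Rightarrow> real ^ 'nx \<Rightarrow> real ^ 'nu"
    and aW aWb cW aVb :: "real \<Rightarrow> real"
  assumes U_nonempty: "\<And>x. U x \<noteq> {}"
    and l_nonneg: "\<And>x u. 0 \<le> l x u"
    and sigma_cont: "continuous_on UNIV \<sigma>" and sigma_nonneg: "\<And>x. 0 \<le> \<sigma> x"
    and h0_sel: "selection h0 U"
    and SA1: "\<And>x. \<exists>u. admissible f U x u \<and> input_cost f l x u = optimal_cost f U l x \<and>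
                 optimal_cost f U l x < \<infinity>"
    and W_cont: "continuous_on UNIV W" and W_nonneg: "\<And>x. 0 \<le> W x"
    and aW: "class_Kinf aW" and cW: "class_Kinf cW"
    and aWb_cont: "continuous_on {0..} aWb" and aWb_mono: "mono_on {0..} aWb"
    and aWb_zero: "aWb 0 = 0"
    and SA2_bound: "\<And>x u. u \<in> U x \<Longrightarrow> W x \<le> aWb (\<sigma> x)"
    and SA2_decrease: "\<And>x u. u \<in> U x \<Longrightarrow> W (f x u) - W x \<le> - aW (\<sigma> x) + cW (l x u)"
    and aVb: "class_Kinf aVb"
    and SA3: "\<And>x. policy_cost f l h0 x \<le> ennreal (aVb (\<sigma> x))"
    and PI_init: "h 0 = h0"
    and PI_step: "\<And>i. selection (h (Suc i)) (PI_inputs f U l h (Suc i))"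
    and PI_feasible: "\<And>i x. 0 < i \<Longrightarrow> PI_inputs f U l h i x \<noteq> {}"
  shows "class_KL (beta_Y aW aWb cW aVb) \<and>
         (\<forall>i x \<phi>. \<phi> 0 = x \<longrightarrow> (\<forall>k. \<phi> (Suc k) \<in> PI_dynamics f U l h i (\<phi> k)) \<longrightarrow>
            (\<forall>k. \<sigma> (\<phi> k) \<le> beta_Y aW aWb cW aVb (\<sigma> x) k))"
proof -
  interpret Lyapunov_bounds aW aWb cW aVb
    by standard (fact aW cW aVb aWb_cont aWb_mono aWb_zero)+
  have h_in: "h i x \<in> U x" for i x
  proof (cases i)
    case 0
    then show ?thesis using h0_sel U_nonempty PI_init by (simp add: selection_def)
  next
    case (Suc j)
    then have "h i x \<in> PI_inputs f U l h (Suc j) x"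
      using PI_step[of j] PI_feasible[of "Suc j" x] by (auto simp: selection_def)
    then show ?thesis using Suc by (simp add: PI_inputs_def is_arg_min_def)
  qed
  have cost_le: "policy_cost f l (h i) x \<le> ennreal (aVb (\<sigma> x))" for i x
  proof (induction i)
    case 0
    then show ?case using SA3 PI_init by simp
  next
    case (Suc i)
    have "h (Suc i) z \<in> PI_inputs f U l h (Suc i) z" for z
      using PI_step[of i] PI_feasible[of "Suc i" z] by (auto simp: selection_def)
    then have "ennreal (l z (h (Suc i) z)) + policy_cost f l (h i) (f z (h (Suc i) z))
        \<le> policy_cost f l (h i) z" for z
      \<comment> \<open>The cost of the old policy satisfies the Bellman inequality for the new one,
        so \<open>policy_cost_le\<close> gives monotone improvement.\<close>
      using PI_inputs_Suc_cost(2)[of "h (Suc i) z" f U l h i z] h_in by blast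
    then have "policy_cost f l (h (Suc i)) x \<le> policy_cost f l (h i) x"
      by (rule policy_cost_le)
    then show ?case using Suc by (rule order.trans)
  qed
  have "\<sigma> (\<phi> k) \<le> beta_Y aW aWb cW aVb (\<sigma> (\<phi> 0)) k"
    if sol: "\<And>k. \<phi> (Suc k) \<in> PI_dynamics f U l h i (\<phi> k)" for i \<phi> k
  proof -
    \<comment> \<open>Truncated subtraction serves both cases: \<open>m\<close> is the preceding
      iteration if \<open>i\<close> is positive and 0 if \<open>i = 0\<close>.\<close>
    define m where "m = i - 1"
    define V where "V x = enn2real (policy_cost f l (h m) x)" for x
    \<comment> \<open>The bound \<open>cost_le\<close> makes the cost finite, so passing to reals
      loses nothing.\<close>
    have V_eq: "ennreal (V x) = policy_cost f l (h m) x" for x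
      unfolding V_def by (intro ennreal_enn2real le_less_trans[OF cost_le ennreal_less_top])
    have V_nonneg: "0 \<le> V x" for x by (simp add: V_def)
    have V_le: "V x \<le> aVb (\<sigma> x)" for x
      using cost_le[of m x] Kinf_nonneg[OF aVb sigma_nonneg, of x]
      by (simp add: ennreal_le_iff flip: V_eq)
    have "\<exists>u. u \<in> U (\<phi> k) \<and> \<phi> (Suc k) = f (\<phi> k) u \<and> l (\<phi> k) u + V (\<phi> (Suc k)) \<le> V (\<phi> k)" for k
    proof -
      obtain u where u: "u \<in> PI_inputs f U l h i (\<phi> k)" "\<phi> (Suc k) = f (\<phi> k) u"
        using sol[of k] by (auto simp: PI_dynamics_def)
      have "u \<in> U (\<phi> k) \<and>
        ennreal (l (\<phi> k) u) + policy_cost f l (h m) (f (\<phi> k) u)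
          \<le> policy_cost f l (h m) (\<phi> k)"
      proof (cases i)
        \<comment> \<open>For the initial policy the only input is \<open>h 0\<close>, and the
          required inequality is the Bellman equation of \<open>h 0\<close>.\<close>
        case 0
        then have "u = h 0 (\<phi> k)" using u by (simp add: PI_inputs_def)
        then show ?thesis
          using 0 h_in[of 0 "\<phi> k"] policy_cost_unfold[of f l "h 0" "\<phi> k"] by (simp add: m_def)
      next
        case (Suc j)
        then show ?thesis using PI_inputs_Suc_cost[of u f U l h j "\<phi> k"] h_in u(1) by (simp add: m_def)
      qed
      then show ?thesis
        using u(2) l_nonneg V_nonneg
        by (intro exI[of _ u]) (simp add: ennreal_le_iff flip: V_eq ennreal_plus)
    qed
    \<comment> \<open>A solution of the inclusion may use a different minimiser at each time, even
      when it revisits a state, so inputs are chosen per time instant and not by a feedback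
      law.\<close>
    then obtain u where u: "\<And>k. u k \<in> U (\<phi> k)" "\<And>k. \<phi> (Suc k) = f (\<phi> k) (u k)"
        "\<And>k. l (\<phi> k) (u k) + V (\<phi> (Suc k)) \<le> V (\<phi> k)"
      by metis
    have "W (\<phi> (Suc k)) \<le> W (\<phi> k) - aW (\<sigma> (\<phi> k)) + cW (l (\<phi> k) (u k))" for k
      using SA2_decrease[OF u(1)[of k]] by (simp add: u(2))
    then show ?thesis
      using u(3) SA2_bound[OF u(1)] V_le
      by (intro beta_Y_bound[of "\<lambda>k. \<sigma> (\<phi> k)" "\<lambda>k. V (\<phi> k)" "\<lambda>k. W (\<phi> k)" "\<lambda>k. l (\<phi> k) (u k)"]
          sigma_nonneg V_nonneg W_nonneg l_nonneg)
  qed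
  then show ?thesis using KL_beta_Y by blast
qed

end
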